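(* Let $\&$ be the minimum (G\"odel) t-norm. A net $\{u_i\}_{i\in D}$ in $\mathbb{E}^1$ $S_{\wedge}$-converges to $u\in\mathbb{E}^1$ if and only if for every $r<1$ there exists $i_0\in D$ such that for all $i\ge i_0$ and all $x\in\mathbb{R}$, $$u_i(x)=u(x)\quad\text{or}\quad\min\bigl(u_i(x),u(x)\bigr)>r.$$
   Context: The minimum (G\"odel) t-norm is $a\,\&\,b=\min(a,b)$ on $[0,1]$, with residuated implication $a\rightarrow c=c$ if $a>c$ and $a\rightarrow c=1$ otherwise. Fuzzy numbers: $\mathbb{E}^1$ is the set of all $u:\mathbb{R}\to[0,1]$ such that (1) $u(x_0)=1$ for some $x_0$; (2) $u(\lambda x+(1-\lambda)y)\ge\min\{u(x),u(y)\}$ for all $x,y\in\mathbb{R}$, $\lambda\in[0,1]$; (3) $u$ is upper semicontinuous; (4) $[u]_0=\overline{\{x: u(x)>0\}}$ is compact. Write $[u]_0=[u_0^-,u_0^+]$ and $[u]_1=\{x:u(x)=1\}=[u_1^-,u_1^+]$. The left part $u^\ell$ and right part $u^r$ are functions $\mathbb{R}\to[0,1]$: $u^\ell(x)=0$ for $x<u_0^-$, $u^\ell(x)=u(x)$ for $x\in[u_0^-,u_1^-]$, $u^\ell(x)=1$ for $x>u_1^-$; and $u^r(x)=1$ for $x<u_1^-$, $u^r(x)=u(x)$ for $x\in[u_1^-,u_0^+]$, $u^r(x)=0$ for $x>u_0^+$. For $u,v\in\mathbb{E}^1$: $P(u,v)=\inf_{x\in\mathbb{R}}\left[(v^\ell(x)\rightarrow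 u^\ell(x))\wedge(u^r(x)\rightarrow v^r(x))\right]$ and $S_{\wedge}(u,v)=P(u,v)\wedge P(v,u)$, using the G\"odel implication. A net $\{u_i\}_{i\in D}$ in $\mathbb{E}^1$ $S_{\wedge}$-converges to $u\in\mathbb{E}^1$ if $\sup_{i\in D}\inf_{j\ge i}S_{\wedge}(u,u_j)=1$ (equivalently, it converges to $u$ in the topology with base the balls $\{v: S_{\wedge}(w,v)>r\}$, $w\in\mathbb{E}^1$, $r<1$). *)

theory Defs
  imports "HOL-Analysis.Analysis"
begin

definition godel_impl :: "real \<Rightarrow> real \<Rightarrow> real" (infixr "\<rightarrow>\<^sub>G" 60) where
  "a \<rightarrow>\<^sub>G c = (if a > c then c else 1)"

lemma godel_impl_residuum:
  assumes "b \<le> 1"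
  shows "min a b \<le> c \<longleftrightarrow> b \<le> (a \<rightarrow>\<^sub>G c)"
  using assms by (auto simp: godel_impl_def min_def)

definition upper_semicont :: "('a::topological_space \<Rightarrow> real) \<Rightarrow> bool" where
  "upper_semicont f \<longleftrightarrow> (\<forall>a. open {x. f x < a})"

text \<open>The zero level set \<open>[u]\<^sub>0\<close> is a closure, not \<open>{x. u x \<ge> 0}\<close>.\<close>

definition level0 :: "(real \<Rightarrow> real) \<Rightarrow> real set" where
  "level0 u = closure {x. u x > 0}"

definition level1 :: "(real \<Rightarrow> real) \<Rightarrow> real set" where
  "level1 u = {x. u x = 1}"

definition fuzzy_numbers :: "(real \<Rightarrow> real) set" where
  "fuzzy_numbers = {u.
     (\<forall>x. u x \<in> {0..1}) \<and>
     (\<exists>x. u x = 1) \<and>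
     (\<forall>x y. \<forall>t\<in>{0..1}. u (t * x + (1 - t) * y) \<ge> min (u x) (u y)) \<and>
     upper_semicont u \<and>
     compact (level0 u)}"

text \<open>The endpoints are given by \<open>Inf\<close> and \<open>Sup\<close>; for fuzzy numbers the two level sets are
  indeed the compact intervals with these endpoints, see \<open>level0_eq\<close> and \<open>level1_eq\<close>.\<close>

definition lo0 :: "(real \<Rightarrow> real) \<Rightarrow> real" where "lo0 u = Inf (level0 u)"
definition hi0 :: "(real \<Rightarrow> real) \<Rightarrow> real" where "hi0 u = Sup (level0 u)"
definition lo1 :: "(real \<Rightarrow> real) \<Rightarrow> real" where "lo1 u = Inf (level1 u)"
definition hi1 :: "(real \<Rightarrow> real) \<Rightarrow> real" where "hi1 u = Sup (level1 u)"

lemma compact_convex_eq_Icc: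
  fixes S :: "real set"
  assumes "compact S" "convex S" "S \<noteq> {}"
  shows "S = {Inf S..Sup S}"
proof -
  have "connected S" using assms(2) by (rule convex_connected)
  then obtain a b where ab: "S = {a..b}"
    using assms(1) connected_compact_interval_1 by blast
  with assms(3) have "a \<le> b" by auto
  with ab show ?thesis by simp
qed

lemma level0_eq:
  assumes "u \<in> fuzzy_numbers"
  shows "level0 u = {lo0 u..hi0 u}"
proof -
  have q: "min (u x) (u y) \<le> u (t * x + (1 - t) * y)" if "0 \<le> t" "t \<le> 1" for x y t
    using assms that by (auto simp: fuzzy_numbers_def)
  have "convex {x. u x > 0}"
    unfolding convex_alt
  proof (clarsimp)
    fix x y t :: real assume "0 < u x" "0 < u y" "0 \<le> t" "t \<le> 1"
    then show "0 < u ((1 - t) * x + t * y)" using q[of t y x] by (simp add: add.commute)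
  qed
  then have "convex (level0 u)" unfolding level0_def by (rule convex_closure)
  moreover obtain x where "u x = 1" using assms by (auto simp: fuzzy_numbers_def)
  then have "x \<in> level0 u"
    unfolding level0_def using closure_subset[of "{x. u x > 0}"] by auto
  moreover have "compact (level0 u)" using assms by (simp add: fuzzy_numbers_def)
  ultimately show ?thesis unfolding lo0_def hi0_def using compact_convex_eq_Icc by blast
qed

lemma level1_eq:
  assumes "u \<in> fuzzy_numbers"
  shows "level1 u = {lo1 u..hi1 u}"
proof -
  have le1: "u x \<le> 1" for x using assms by (auto simp: fuzzy_numbers_def)
  have q: "min (u x) (u y) \<le> u (t * x + (1 - t) * y)" if "0 \<le> t" "t \<le> 1" for x y t
    using assms that by (auto simp: fuzzy_numbers_def)
  have "convex (level1 u)"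
    unfolding convex_alt level1_def
  proof (clarsimp)
    fix x y t :: real assume "u x = 1" "u y = 1" "0 \<le> t" "t \<le> 1"
    then show "u ((1 - t) * x + t * y) = 1"
      using q[of t y x] le1[of "(1 - t) * x + t * y"] by (simp add: add.commute)
  qed
  moreover have "compact (level1 u)"
  proof -
    have "level1 u = - {x. u x < 1}" using le1 by (auto simp: level1_def antisym not_less)
    then have "closed (level1 u)"
      using assms by (simp add: fuzzy_numbers_def upper_semicont_def closed_def)
    moreover have "level1 u \<subseteq> level0 u"
      unfolding level0_def level1_def using closure_subset[of "{x. u x > 0}"] by auto
    moreover have "compact (level0 u)" using assms by (simp add: fuzzy_numbers_def)
    ultimately show ?thesis using compact_Int_closed[of "level0 u" "level1 u"]
      by (simp add: Int_absorb1)
  qed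
  moreover have "level1 u \<noteq> {}" using assms by (auto simp: fuzzy_numbers_def level1_def)
  ultimately show ?thesis unfolding lo1_def hi1_def using compact_convex_eq_Icc by blast
qed

definition left_part :: "(real \<Rightarrow> real) \<Rightarrow> real \<Rightarrow> real" where
  "left_part u x = (if x < lo0 u then 0 else if x \<le> lo1 u then u x else 1)"

text \<open>The right part also switches at \<open>lo1 u\<close>, not at \<open>hi1 u\<close>; on \<open>level1 u\<close>
  this makes no difference.\<close>

definition right_part :: "(real \<Rightarrow> real) \<Rightarrow> real \<Rightarrow> real" where
  "right_part u x = (if x < lo1 u then 1 else if x \<le> hi0 u then u x else 0)"

definition fuzzy_P :: "(real \<Rightarrow> real) \<Rightarrow> (real \<Rightarrow> real) \<Rightarrow> real" where
  "fuzzy_P u v = (INF x. min (left_part v x \<rightarrow>\<^sub>G left_part u x) (right_part u x \<rightarrow>\<^sub>G right_part v x))"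

definition S_min :: "(real \<Rightarrow> real) \<Rightarrow> (real \<Rightarrow> real) \<Rightarrow> real" where
  "S_min u v = min (fuzzy_P u v) (fuzzy_P v u)"

text \<open>A net is indexed by a set \<open>D\<close> with a relation \<open>R\<close>, where \<open>(i, j) \<in> R\<close> means \<open>i \<le> j\<close>.\<close>

definition directed_on :: "'i set \<Rightarrow> ('i \<times> 'i) set \<Rightarrow> bool" where
  "directed_on D R \<longleftrightarrow> D \<noteq> {} \<and> preorder_on D R \<and>
     (\<forall>i\<in>D. \<forall>j\<in>D. \<exists>k\<in>D. (i, k) \<in> R \<and> (j, k) \<in> R)"

definition S_min_converges ::
  "'i set \<Rightarrow> ('i \<times> 'i) set \<Rightarrow> ('i \<Rightarrow> real \<Rightarrow> real) \<Rightarrow> (real \<Rightarrow> real) \<Rightarrow> bool" where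
  "S_min_converges D R w u \<longleftrightarrow>
     (SUP i\<in>D. INF j\<in>{j\<in>D. (i, j) \<in> R}. S_min u (w j)) = 1"

end

theory Submission
  imports Defs
begin

text \<open>
  The minimum of the two implications \<open>a \<rightarrow>\<^sub>G b\<close> and \<open>b \<rightarrow>\<^sub>G a\<close> is \<open>1\<close> if \<open>a = b\<close> and
  \<open>min a b\<close> otherwise, so \<open>s \<le> S_min u v\<close> says that at every point the left parts of \<open>u\<close> and \<open>v\<close>
  agree or are both at least \<open>s\<close>, and likewise the right parts. The point of the proof is that this
  is the same as the condition ``equal or both at least \<open>s\<close>'' on \<open>u\<close> and \<open>v\<close> themselves
  (\<open>le_S_min_iff\<close>), that is, \<open>S_min\<close> can be computed without splitting the fuzzy numbers.

  One direction uses that \<open>u\<close> is the pointwise minimum of its two parts, and that \<open>min\<close> preserves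
  the relation ``equal or both at least \<open>s\<close>''. For the other direction, \<open>left_part u x\<close> is the least
  upper bound of \<open>u\<close> on \<open>{..x}\<close>, since \<open>u\<close> increases up to \<open>lo1 u\<close>. If this bound is below \<open>s\<close>, then
  \<open>u\<close> is below \<open>s\<close> on all of \<open>{..x}\<close>, so \<open>v\<close> equals \<open>u\<close> there and has the same bound. The right
  parts are treated in the same way on \<open>{x..}\<close>.

  As \<open>S_min\<close> has values in \<open>[0, 1]\<close>, convergence means that \<open>S_min u (w j)\<close> is eventually above
  each \<open>r < 1\<close> (\<open>S_min_converges_iff\<close>). The passage between the strict bounds of the theorem and
  the weak bounds that suit infima is harmless because \<open>r\<close> ranges over all reals below \<open>1\<close>.
\<close>

section \<open>Fuzzy numbers as minima of monotone parts\<close>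

lemma fuzzy_number_nonneg: "u \<in> fuzzy_numbers \<Longrightarrow> 0 \<le> u x"
  and fuzzy_number_le_1: "u \<in> fuzzy_numbers \<Longrightarrow> u x \<le> 1"
  by (auto simp: fuzzy_numbers_def)

lemma fuzzy_number_quasiconcave:
  assumes u: "u \<in> fuzzy_numbers" and "x \<le> y" "y \<le> z"
  shows "min (u x) (u z) \<le> u y"
proof -
  have "y \<in> closed_segment x z" using assms(2,3) by (simp add: closed_segment_eq_real_ivl)
  then obtain t where t: "0 \<le> t" "t \<le> 1" "y = (1 - t) * x + t * z"
    by (auto simp: closed_segment_def)
  have "min (u z) (u x) \<le> u (t * z + (1 - t) * x)"
    using u t(1,2) by (auto simp: fuzzy_numbers_def)
  with t(3) show ?thesis by (simp add: add.commute min.commute)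
qed

lemma fuzzy_number_lo1:
  assumes "u \<in> fuzzy_numbers"
  shows "u (lo1 u) = 1"
proof -
  have "level1 u \<noteq> {}" using assms by (auto simp: fuzzy_numbers_def level1_def)
  then have "lo1 u \<in> level1 u" by (simp add: level1_eq[OF assms])
  then show ?thesis by (simp add: level1_def)
qed

lemma fuzzy_number_eq_0_outside:
  assumes u: "u \<in> fuzzy_numbers" and "x < lo0 u \<or> hi0 u < x"
  shows "u x = 0"
proof -
  have "x \<notin> level0 u" using assms(2) by (auto simp: level0_eq[OF u])
  then have "\<not> 0 < u x" using closure_subset[of "{x. u x > 0}"] by (auto simp: level0_def)
  with fuzzy_number_nonneg[OF u, of x] show ?thesis by simp
qed

lemma fuzzy_number_mono_below_lo1:
  assumes u: "u \<in> fuzzy_numbers" and "x \<le> y" "y \<le> lo1 u"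
  shows "u x \<le> u y"
  using fuzzy_number_quasiconcave[OF assms] fuzzy_number_le_1[OF u, of x]
  by (simp add: fuzzy_number_lo1[OF u] min_def split: if_splits)

lemma fuzzy_number_antimono_above_lo1:
  assumes u: "u \<in> fuzzy_numbers" and "lo1 u \<le> x" "x \<le> y"
  shows "u y \<le> u x"
  using fuzzy_number_quasiconcave[OF assms] fuzzy_number_le_1[OF u, of y]
  by (simp add: fuzzy_number_lo1[OF u] min_def split: if_splits)

text \<open>The condition on all \<open>c\<close> identifies \<open>left_part u x\<close> as the supremum of \<open>u\<close> on \<open>{..x}\<close>: \<open>u\<close> vanishes
  before \<open>lo0 u\<close>, increases until \<open>lo1 u\<close>, and has its maximal value \<open>1\<close> there. In this form the
  left part can be compared with \<open>u\<close> without a case distinction on where \<open>x\<close> lies.\<close>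

lemma left_part_le_iff:
  assumes u: "u \<in> fuzzy_numbers"
  shows "left_part u x \<le> c \<longleftrightarrow> (\<forall>y\<le>x. u y \<le> c)"
proof -
  consider "x < lo0 u" | "\<not> x < lo0 u" "x \<le> lo1 u" | "\<not> x < lo0 u" "lo1 u < x" by linarith
  then show ?thesis
  proof cases
    case 1
    then have "u y = 0" if "y \<le> x" for y
      using that by (intro fuzzy_number_eq_0_outside[OF u]) linarith
    with 1 show ?thesis by (auto simp: left_part_def)
  next
    case 2
    then show ?thesis
      using fuzzy_number_mono_below_lo1[OF u, of _ x] by (auto simp: left_part_def intro: order_trans)
  next
    case 3
    then show ?thesis
      using fuzzy_number_lo1[OF u] fuzzy_number_le_1[OF u]
      by (auto simp: left_part_def intro: order_trans dest: spec[of _ "lo1 u"])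
  qed
qed

lemma right_part_le_iff:
  assumes u: "u \<in> fuzzy_numbers"
  shows "right_part u x \<le> c \<longleftrightarrow> (\<forall>y\<ge>x. u y \<le> c)"
proof -
  consider "x < lo1 u" | "\<not> x < lo1 u" "x \<le> hi0 u" | "\<not> x < lo1 u" "hi0 u < x" by linarith
  then show ?thesis
  proof cases
    case 1
    then show ?thesis
      using fuzzy_number_lo1[OF u] fuzzy_number_le_1[OF u]
      by (auto simp: right_part_def intro: order_trans dest: spec[of _ "lo1 u"])
  next
    case 2
    then show ?thesis
      using fuzzy_number_antimono_above_lo1[OF u, of x]
      by (auto simp: right_part_def intro: order_trans)
  next
    case 3
    then have "u y = 0" if "y \<ge> x" for y
      using that by (intro fuzzy_number_eq_0_outside[OF u]) linarith
    with 3 show ?thesis by (auto simp: right_part_def)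
  qed
qed

lemma part_bounds:
  assumes "u \<in> fuzzy_numbers"
  shows "0 \<le> left_part u x" "left_part u x \<le> 1" "0 \<le> right_part u x" "right_part u x \<le> 1"
  using fuzzy_number_nonneg[OF assms] fuzzy_number_le_1[OF assms]
  by (auto simp: left_part_def right_part_def)

lemma fuzzy_number_eq_min_parts:
  assumes u: "u \<in> fuzzy_numbers"
  shows "u x = min (left_part u x) (right_part u x)"
proof -
  have "lo1 u \<le> hi0 u"
    using fuzzy_number_eq_0_outside[OF u, of "lo1 u"] fuzzy_number_lo1[OF u]
    by (cases "hi0 u < lo1 u") auto
  then show ?thesis
    using fuzzy_number_nonneg[OF u, of x] fuzzy_number_le_1[OF u, of x]
      fuzzy_number_eq_0_outside[OF u, of x] fuzzy_number_lo1[OF u]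
    by (cases x "lo1 u" rule: linorder_cases) (auto simp: left_part_def right_part_def)
qed

section \<open>Thresholds of the similarity\<close>

text \<open>A weak threshold \<open>s\<close> passes through the infimum that defines \<open>fuzzy_P\<close>; a strict one would
  not.\<close>

lemma le_fuzzy_P_iff:
  assumes u: "u \<in> fuzzy_numbers" and v: "v \<in> fuzzy_numbers"
  shows "s \<le> fuzzy_P u v \<longleftrightarrow>
    (\<forall>x. s \<le> (left_part v x \<rightarrow>\<^sub>G left_part u x) \<and> s \<le> (right_part u x \<rightarrow>\<^sub>G right_part v x))"
proof -
  have "bdd_below (range (\<lambda>x. min (left_part v x \<rightarrow>\<^sub>G left_part u x)
      (right_part u x \<rightarrow>\<^sub>G right_part v x)))"
    using part_bounds[OF u] part_bounds[OF v]
    by (intro bdd_belowI[of _ 0]) (auto simp: godel_impl_def)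
  then show ?thesis unfolding fuzzy_P_def by (subst le_cINF_iff) auto
qed

text \<open>If \<open>a \<noteq> b\<close>, then the implication from the smaller to the larger is \<open>1\<close>, and the converse
  implication is the smaller of the two.\<close>

lemma le_godel_impl_both_iff:
  assumes "s \<le> 1"
  shows "s \<le> (a \<rightarrow>\<^sub>G b) \<and> s \<le> (b \<rightarrow>\<^sub>G a) \<longleftrightarrow> a = b \<or> s \<le> min a b"
  using assms by (auto simp: godel_impl_def)

text \<open>Both parts of a fuzzy number are bounds of this kind, with \<open>A = {..x}\<close> or \<open>A = {x..}\<close>. The
  least bound \<open>a\<close> of \<open>f\<close> being below \<open>s\<close> forces \<open>f\<close> below \<open>s\<close>, hence \<open>g = f\<close> on \<open>A\<close>; by symmetry
  the same follows if the bound of \<open>g\<close> is below \<open>s\<close>.\<close>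

lemma least_bounds_eq_or_ge:
  fixes a b s :: real
  assumes f: "\<And>c. a \<le> c \<longleftrightarrow> (\<forall>y\<in>A. f y \<le> c)"
    and g: "\<And>c. b \<le> c \<longleftrightarrow> (\<forall>y\<in>A. g y \<le> c)"
    and fg: "\<forall>y\<in>A. f y = g y \<or> s \<le> min (f y) (g y)"
  shows "a = b \<or> s \<le> min a b"
proof (rule disjCI)
  assume "\<not> s \<le> min a b"
  then have "a < s \<or> b < s" by auto
  moreover have "\<forall>y\<in>A. f y \<le> a" "\<forall>y\<in>A. g y \<le> b"
    using f[of a] g[of b] by simp_all
  ultimately have "\<forall>y\<in>A. f y = g y" using fg by force
  then have "a \<le> c \<longleftrightarrow> b \<le> c" for c using f[of c] g[of c] by simp
  from this[of a] this[of b] show "a = b" by simp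
qed

text \<open>From the parts one returns to the fuzzy number by taking the minimum; from the fuzzy number one
  reaches the parts by taking suprema over the half-lines ending or starting at \<open>x\<close>. Both operations
  preserve the relation ``equal or both at least \<open>s\<close>''.\<close>

lemma le_S_min_iff:
  assumes u: "u \<in> fuzzy_numbers" and v: "v \<in> fuzzy_numbers" and "s \<le> 1"
  shows "s \<le> S_min u v \<longleftrightarrow> (\<forall>x. u x = v x \<or> s \<le> min (u x) (v x))"
proof -
  let ?L = "\<lambda>x. left_part u x = left_part v x \<or> s \<le> min (left_part u x) (left_part v x)"
  let ?R = "\<lambda>x. right_part u x = right_part v x \<or> s \<le> min (right_part u x) (right_part v x)"
  have "s \<le> S_min u v \<longleftrightarrow> (\<forall>x. ?L x \<and> ?R x)"
    unfolding S_min_def min.bounded_iff[of s "fuzzy_P u v"] le_fuzzy_P_iff[OF u v]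
      le_fuzzy_P_iff[OF v u] le_godel_impl_both_iff[OF \<open>s \<le> 1\<close>, symmetric]
    by blast
  also have "\<dots> \<longleftrightarrow> (\<forall>x. u x = v x \<or> s \<le> min (u x) (v x))"
  proof (intro iffI allI)
    fix x assume "\<forall>x. ?L x \<and> ?R x"
    then have "?L x" "?R x" by auto
    then show "u x = v x \<or> s \<le> min (u x) (v x)"
      unfolding fuzzy_number_eq_min_parts[OF u, of x] fuzzy_number_eq_min_parts[OF v, of x]
      by (auto simp: min_def split: if_splits)
  next
    fix x assume uv: "\<forall>x. u x = v x \<or> s \<le> min (u x) (v x)"
    have "?L x"
    proof (rule least_bounds_eq_or_ge[where A = "{..x}"])
      show "left_part u x \<le> c \<longleftrightarrow> (\<forall>y\<in>{..x}. u y \<le> c)" for c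
        using left_part_le_iff[OF u] by auto
      show "left_part v x \<le> c \<longleftrightarrow> (\<forall>y\<in>{..x}. v y \<le> c)" for c
        using left_part_le_iff[OF v] by auto
    qed (use uv in auto)
    moreover have "?R x"
    proof (rule least_bounds_eq_or_ge[where A = "{x..}"])
      show "right_part u x \<le> c \<longleftrightarrow> (\<forall>y\<in>{x..}. u y \<le> c)" for c
        using right_part_le_iff[OF u] by auto
      show "right_part v x \<le> c \<longleftrightarrow> (\<forall>y\<in>{x..}. v y \<le> c)" for c
        using right_part_le_iff[OF v] by auto
    qed (use uv in auto)
    ultimately show "?L x \<and> ?R x" ..
  qed
  finally show ?thesis .
qed

section \<open>Convergence\<close>

lemma S_min_nonneg:
  assumes "u \<in> fuzzy_numbers" "v \<in> fuzzy_numbers"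
  shows "0 \<le> S_min u v"
  using assms by (simp add: le_S_min_iff fuzzy_number_nonneg)

lemma S_min_le_1:
  assumes u: "u \<in> fuzzy_numbers" and v: "v \<in> fuzzy_numbers"
  shows "S_min u v \<le> 1"
proof -
  have "fuzzy_P u v \<le> (left_part v 0 \<rightarrow>\<^sub>G left_part u 0)"
    using le_fuzzy_P_iff[OF u v, of "fuzzy_P u v"] by simp
  also have "\<dots> \<le> 1" using part_bounds[OF u] by (simp add: godel_impl_def)
  finally show ?thesis by (simp add: S_min_def)
qed

lemma S_min_converges_iff:
  assumes D: "directed_on D R" and w: "\<And>i. i \<in> D \<Longrightarrow> w i \<in> fuzzy_numbers"
    and u: "u \<in> fuzzy_numbers"
  shows "S_min_converges D R w u \<longleftrightarrow>
    (\<forall>r<1. \<exists>i\<in>D. \<forall>j\<in>D. (i, j) \<in> R \<longrightarrow> r < S_min u (w j))"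
proof -
  define tail where "tail i = {j\<in>D. (i, j) \<in> R}" for i
  define m where "m i = (INF j\<in>tail i. S_min u (w j))" for i
  have self: "i \<in> tail i" if "i \<in> D" for i
    using D that by (auto simp: tail_def directed_on_def preorder_on_def dest: refl_onD)
  have bdd: "bdd_below ((\<lambda>j. S_min u (w j)) ` tail i)" for i
    using S_min_nonneg[OF u w] by (intro bdd_belowI[of _ 0]) (auto simp: tail_def)
  have m_lower: "m i \<le> S_min u (w j)" if "j \<in> tail i" for i j
    unfolding m_def using bdd that by (rule cINF_lower)
  have m_le_1: "m i \<le> 1" if "i \<in> D" for i
    using m_lower[OF self[OF that]] S_min_le_1[OF u w[OF that]] by linarith
  have "D \<noteq> {}" using D by (simp add: directed_on_def)
  have bdd_m: "bdd_above (m ` D)" using m_le_1 by (auto intro: bdd_aboveI[of _ 1])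
  have eq_1_iff: "a = 1 \<longleftrightarrow> (\<forall>r<1. r < a)" if "a \<le> 1" for a :: real
  proof
    assume *: "\<forall>r<1. r < a"
    have "\<not> a < 1"
    proof
      assume "a < 1"
      from *[rule_format, OF this] show False by simp
    qed
    with that show "a = 1" by simp
  qed simp
  have "(SUP i\<in>D. m i) \<le> 1" using \<open>D \<noteq> {}\<close> m_le_1 by (rule cSUP_least)
  then have "(SUP i\<in>D. m i) = 1 \<longleftrightarrow> (\<forall>r<1. r < (SUP i\<in>D. m i))"
    by (rule eq_1_iff)
  also have "\<dots> \<longleftrightarrow> (\<forall>r<1. \<exists>i\<in>D. r < m i)"
    using less_cSUP_iff[OF \<open>D \<noteq> {}\<close> bdd_m] by simp
  also have "\<dots> \<longleftrightarrow> (\<forall>r<1. \<exists>i\<in>D. \<forall>j\<in>tail i. r < S_min u (w j))"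
  proof (intro iffI allI impI)
    fix r :: real assume "\<forall>r<1. \<exists>i\<in>D. r < m i" "r < 1"
    then obtain i where "i \<in> D" "r < m i" by blast
    then show "\<exists>i\<in>D. \<forall>j\<in>tail i. r < S_min u (w j)"
      by (intro bexI[of _ i] ballI) (rule less_le_trans[OF _ m_lower])
  next
    fix r :: real assume *: "\<forall>r<1. \<exists>i\<in>D. \<forall>j\<in>tail i. r < S_min u (w j)" and "r < 1"
    \<comment> \<open>The infimum over a tail may attain the bound, so it needs room above \<open>r\<close>.\<close>
    obtain t where "r < t" "t < 1" using dense[OF \<open>r < 1\<close>] by blast
    with * obtain i where i: "i \<in> D" "\<forall>j\<in>tail i. t < S_min u (w j)" by blast
    have "tail i \<noteq> {}" using self[OF i(1)] by blast
    then have "t \<le> m i"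
      unfolding m_def by (rule cINF_greatest) (rule less_imp_le[OF i(2)[rule_format]])
    with \<open>r < t\<close> have "r < m i" by (rule less_le_trans)
    with i(1) show "\<exists>i\<in>D. r < m i" ..
  qed
  finally show ?thesis by (simp add: S_min_converges_def m_def tail_def Ball_def imp_conjL)
qed

theorem proposition3p9:
  fixes D :: "'i set" and R :: "('i \<times> 'i) set"
    and w :: "'i \<Rightarrow> real \<Rightarrow> real" and u :: "real \<Rightarrow> real"
  assumes "directed_on D R"
    and "\<And>i. i \<in> D \<Longrightarrow> w i \<in> fuzzy_numbers"
    and "u \<in> fuzzy_numbers"
  shows "S_min_converges D R w u \<longleftrightarrow>
    (\<forall>r<1. \<exists>i0\<in>D. \<forall>i\<in>D. (i0, i) \<in> R \<longrightarrow>
       (\<forall>x. w i x = u x \<or> min (w i x) (u x) > r))"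
proof -
  note w = assms(2) and u = assms(3)
  have "S_min_converges D R w u \<longleftrightarrow>
      (\<forall>r<1. \<exists>i\<in>D. \<forall>j\<in>D. (i, j) \<in> R \<longrightarrow> r < S_min u (w j))"
    using assms by (intro S_min_converges_iff) auto
  also have "\<dots> \<longleftrightarrow> (\<forall>r<1. \<exists>i0\<in>D. \<forall>i\<in>D. (i0, i) \<in> R \<longrightarrow>
      (\<forall>x. w i x = u x \<or> min (w i x) (u x) > r))"
  proof (intro iffI allI impI)
    fix r :: real
    assume "r < 1" and "\<forall>r<1. \<exists>i\<in>D. \<forall>j\<in>D. (i, j) \<in> R \<longrightarrow> r < S_min u (w j)"
    then obtain i0 where i0: "i0 \<in> D" "\<forall>j\<in>D. (i0, j) \<in> R \<longrightarrow> r < S_min u (w j)"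
      using \<open>r < 1\<close> by blast
    have "w i x = u x \<or> r < min (w i x) (u x)" if i: "i \<in> D" "(i0, i) \<in> R" for i x
    proof -
      \<comment> \<open>The weak threshold \<open>S_min u (w i)\<close> itself lies strictly above \<open>r\<close>.\<close>
      have "u x = w i x \<or> S_min u (w i) \<le> min (u x) (w i x)"
        using le_S_min_iff[OF u w[OF i(1)] S_min_le_1[OF u w[OF i(1)]]] by simp
      moreover have "r < S_min u (w i)" using i0(2) i by blast
      ultimately show ?thesis by auto
    qed
    with i0(1) show "\<exists>i0\<in>D. \<forall>i\<in>D. (i0, i) \<in> R \<longrightarrow> (\<forall>x. w i x = u x \<or> r < min (w i x) (u x))"
      by blast
  next
    fix r :: real
    assume "r < 1" and *: "\<forall>r<1. \<exists>i0\<in>D. \<forall>i\<in>D. (i0, i) \<in> R \<longrightarrow>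
      (\<forall>x. w i x = u x \<or> r < min (w i x) (u x))"
    obtain t where t: "r < t" "t < 1" using dense[OF \<open>r < 1\<close>] by blast
    with * obtain i0 where i0: "i0 \<in> D"
      "\<forall>i\<in>D. (i0, i) \<in> R \<longrightarrow> (\<forall>x. w i x = u x \<or> t < min (w i x) (u x))" by blast
    have "r < S_min u (w j)" if j: "j \<in> D" "(i0, j) \<in> R" for j
    proof -
      have "u x = w j x \<or> t \<le> min (u x) (w j x)" for x
        using i0(2)[rule_format, OF j, of x] by auto
      then have "t \<le> S_min u (w j)" using le_S_min_iff[OF u w[OF j(1)]] t(2) by simp
      with t(1) show ?thesis by simp
    qed
    with i0(1) show "\<exists>i\<in>D. \<forall>j\<in>D. (i, j) \<in> R \<longrightarrow> r < S_min u (w j)" by blast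
  qed
  finally show ?thesis .
qed

end
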